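(* Let $F$ be a field. There exist finitely generated, infinite-dimensional monomial $F$-algebras all of whose graded deformations contain non-zero nilpotent ideals.
   Context: A monomial algebra is a quotient $A=F\langle x_1,\dots,x_d\rangle/J$ of a free associative algebra by an ideal $J$ generated by monomials. A graded algebra $\widetilde{A}$ is a deformation of $A$ if, with respect to some monomial ordering, its Gröbner basis has the same leading monomials as that of $A$; that is, $\widetilde{A}=F\langle x_1,\dots,x_d\rangle/I$, where $I$ is an ideal that is homogeneous with respect to some assignment of positive integer degrees to the generators $x_1,\dots,x_d$, and the ideal generated by the leading monomials of the elements of $I$ (with respect to that monomial ordering) equals $J$. A monomial ordering is a well-ordering of the monomials of the free algebra compatible with left and right multiplication. *)

theory Defs
  imports
    "HOL-Library.Poly_Mapping"
    "HOL-Algebra.QuotRing"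
    "HOL-Algebra.Ideal_Product"
    "HOL-Algebra.Embedded_Algebras"
begin

text \<open>
  Noncommutative monomials are words in the letters \<open>x\<^sub>0, x\<^sub>1, \<dots>\<close>.  The monoid structure is
  concatenation, written additively because this is what the convolution product of
  \<^theory>\<open>HOL-Library.Poly_Mapping\<close> expects; thus \<open>ncmonom \<Rightarrow>\<^sub>0 'f\<close> with its
  library ring structure is the free algebra on countably many letters.
\<close>

datatype ncmonom = NCMonom (letters: "nat list")

instantiation ncmonom :: monoid_add
begin

definition zero_ncmonom :: ncmonom where
  "0 = NCMonom []"

definition plus_ncmonom :: "ncmonom \<Rightarrow> ncmonom \<Rightarrow> ncmonom" where
  "u + v = NCMonom (letters u @ letters v)"

instance
  by standard (simp_all add: zero_ncmonom_def plus_ncmonom_def)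

end

type_synonym 'f ncpoly = "ncmonom \<Rightarrow>\<^sub>0 'f"

definition monoms :: "nat \<Rightarrow> ncmonom set" where
  "monoms d = {w. set (letters w) \<subseteq> {..<d}}"

text \<open>The free algebra \<open>F\<langle>x\<^sub>0, \<dots>, x\<^bsub>d-1\<^esub>\<rangle>\<close>; the field is the type \<open>'f\<close>.\<close>

definition free_algebra :: "nat \<Rightarrow> 'f::field ncpoly ring" where
  "free_algebra d =
     \<lparr>carrier = {p. Poly_Mapping.keys p \<subseteq> monoms d}, mult = (*), one = 1, zero = 0, add = (+)\<rparr>"

lemma ring_free_algebra: "ring (free_algebra d :: 'f::field ncpoly ring)"
proof -
  have m0: "0 \<in> monoms d"
    by (simp add: monoms_def zero_ncmonom_def)
  have madd: "u + v \<in> monoms d" if "u \<in> monoms d" "v \<in> monoms d" for u v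
    using that by (auto simp: monoms_def plus_ncmonom_def)
  have add: "Poly_Mapping.keys (p + q) \<subseteq> monoms d"
    if "Poly_Mapping.keys p \<subseteq> monoms d" "Poly_Mapping.keys q \<subseteq> monoms d" for p q :: "'f ncpoly"
    using that Poly_Mapping.keys_add[of p q] by blast
  have mult: "Poly_Mapping.keys (p * q) \<subseteq> monoms d"
    if "Poly_Mapping.keys p \<subseteq> monoms d" "Poly_Mapping.keys q \<subseteq> monoms d" for p q :: "'f ncpoly"
    using that Poly_Mapping.keys_mult[of p q] madd by blast
  have one: "Poly_Mapping.keys (1 :: 'f ncpoly) \<subseteq> monoms d"
    using m0 by simp
  have "\<exists>q. Poly_Mapping.keys q \<subseteq> monoms d \<and> q + p = 0" if "Poly_Mapping.keys p \<subseteq> monoms d" for p :: "'f ncpoly"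
    using that by (intro exI[of _ "- p"]) simp
  then show ?thesis
    by (intro ringI abelian_groupI monoidI)
      (use add mult one in \<open>auto simp: free_algebra_def algebra_simps\<close>)
qed

text \<open>A quotient \<open>F\<langle>X\<rangle>/I\<close> is an \<open>F\<close>-algebra through the image of the constants.\<close>

definition quotient_scalars :: "nat \<Rightarrow> 'f::field ncpoly set \<Rightarrow> 'f ncpoly set set" where
  "quotient_scalars d I =
     (\<lambda>c. I +>\<^bsub>free_algebra d\<^esub> Poly_Mapping.single 0 c) ` UNIV"

definition infinite_dimensional_quotient :: "nat \<Rightarrow> 'f::field ncpoly set \<Rightarrow> bool" where
  "infinite_dimensional_quotient d I \<longleftrightarrow>
     \<not> ring.finite_dimension (free_algebra d Quot I) (quotient_scalars d I)
         (carrier (free_algebra d Quot I))"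

definition monomial_ideal :: "nat \<Rightarrow> 'f::field ncpoly set \<Rightarrow> bool" where
  "monomial_ideal d J \<longleftrightarrow>
     (\<exists>M \<subseteq> monoms d. J = Idl\<^bsub>free_algebra d\<^esub> ((\<lambda>w. Poly_Mapping.single w 1) ` M))"

text \<open>
  The order is reflexive: \<open>(u, v) \<in> r\<close> means \<open>u \<le> v\<close>.  As concatenation is cancellative,
  compatibility of \<open>\<le>\<close> is the same as compatibility of \<open><\<close>.
\<close>

definition monomial_ordering :: "nat \<Rightarrow> ncmonom rel \<Rightarrow> bool" where
  "monomial_ordering d r \<longleftrightarrow>
     well_order_on (monoms d) r \<and>
     (\<forall>(u, v) \<in> r. \<forall>a \<in> monoms d. \<forall>b \<in> monoms d. (a + u + b, a + v + b) \<in> r)"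

definition leading_monom :: "ncmonom rel \<Rightarrow> 'f::field ncpoly \<Rightarrow> ncmonom \<Rightarrow> bool" where
  "leading_monom r p w \<longleftrightarrow> w \<in> Poly_Mapping.keys p \<and> (\<forall>v \<in> Poly_Mapping.keys p. (v, w) \<in> r)"

definition leading_ideal :: "nat \<Rightarrow> ncmonom rel \<Rightarrow> 'f::field ncpoly set \<Rightarrow> 'f ncpoly set" where
  "leading_ideal d r I =
     Idl\<^bsub>free_algebra d\<^esub> {Poly_Mapping.single w 1 | p w. p \<in> I \<and> leading_monom r p w}"

definition monom_degree :: "(nat \<Rightarrow> nat) \<Rightarrow> ncmonom \<Rightarrow> nat" where
  "monom_degree \<delta> w = (\<Sum>i\<leftarrow>letters w. \<delta> i)"

definition homogeneous_component :: "(nat \<Rightarrow> nat) \<Rightarrow> nat \<Rightarrow> 'f::field ncpoly \<Rightarrow> 'f ncpoly" where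
  "homogeneous_component \<delta> n p =
     (\<Sum>w \<in> {w \<in> Poly_Mapping.keys p. monom_degree \<delta> w = n}. Poly_Mapping.single w (Poly_Mapping.lookup p w))"

definition homogeneous_ideal :: "nat \<Rightarrow> (nat \<Rightarrow> nat) \<Rightarrow> 'f::field ncpoly set \<Rightarrow> bool" where
  "homogeneous_ideal d \<delta> I \<longleftrightarrow>
     ideal I (free_algebra d) \<and> (\<forall>p \<in> I. \<forall>n. homogeneous_component \<delta> n p \<in> I)"

text \<open>\<open>F\<langle>X\<rangle>/I\<close> is a graded deformation of the monomial algebra \<open>F\<langle>X\<rangle>/J\<close>.\<close>

definition graded_deformation :: "nat \<Rightarrow> 'f::field ncpoly set \<Rightarrow> 'f ncpoly set \<Rightarrow> bool" where
  "graded_deformation d J I \<longleftrightarrow>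
     (\<exists>\<delta>. (\<forall>i<d. 0 < \<delta> i) \<and> homogeneous_ideal d \<delta> I) \<and>
     (\<exists>r. monomial_ordering d r \<and> leading_ideal d r I = J)"

text \<open>
  The power \<open>N\<^sup>n\<close> is taken in the monoid of two-sided ideals of \<open>R\<close> under the ideal product.
\<close>

definition nilpotent_ideal :: "'a set \<Rightarrow> ('a, 'b) ring_scheme \<Rightarrow> bool" where
  "nilpotent_ideal N R \<longleftrightarrow> ideal N R \<and> (\<exists>n::nat. N [^]\<^bsub>ideals_set R\<^esub> n = {\<zero>\<^bsub>R\<^esub>})"

end

theory Submission
  imports Defs
begin

text \<open>
  The example is the algebra \<open>A = F\<langle>x, y\<rangle> / (xy, yx, y\<^sup>2)\<close>, which has the basis \<open>1, x, x\<^sup>2, \<dots>, y\<close>.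
  Let \<open>B = F\<langle>x, y\<rangle> / I\<close> be a deformation of it, graded by positive degrees of \<open>x\<close> and \<open>y\<close>.  By
  Groebner reduction (\<open>normal_form_exists\<close>, \<open>normal_form_unique\<close>) the same words form a basis of
  \<open>B\<close>.  The element \<open>yx\<close> of \<open>B\<close> is homogeneous, and its degree exceeds that of \<open>y\<close>, so it is a
  multiple of a power of \<open>x\<close>, say \<open>yx = a x\<^bsup>k+1\<^esup>\<close>; if \<open>a \<noteq> 0\<close>, then \<open>x\<^sup>k\<close> has the degree of \<open>y\<close>, and
  in particular \<open>k \<ge> 1\<close>.  Then the homogeneous element \<open>z = y - a x\<^sup>k\<close> satisfies \<open>z x = 0\<close>, and \<open>z\<close>
  and the powers of \<open>x\<close> again form a basis.

  Consider the left annihilator \<open>N = {p. p x = 0}\<close> of \<open>x\<close> in \<open>B\<close>, which is a left ideal.  It is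
  also a right ideal (\<open>annihilator_ideal\<close>): modulo the multiples of \<open>z\<close>, each \<open>q \<in> B\<close> is a polynomial
  \<open>f\<close> in \<open>x\<close>, so \<open>q x = f x = x f\<close>, and \<open>p q x = (p x) f = 0\<close> for \<open>p \<in> N\<close>.  Since multiplication by
  \<open>x\<close> is injective on the polynomials in \<open>x\<close>, one gets \<open>N = F z\<close>.  Hence \<open>z\<^sup>2 = s z\<close> for a scalar \<open>s\<close>,
  and comparing degrees gives \<open>z\<^sup>2 = 0\<close> (\<open>annihilator_square_zero\<close>).  So \<open>N\<close> is a non-zero ideal
  with \<open>N\<^sup>2 = 0\<close>.
\<close>

section \<open>Words and homogeneous polynomials\<close>

lemma ncmonom_add_left_cancel: "u + v = u + w \<longleftrightarrow> v = w" for u v w :: ncmonom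
  by (metis append_eq_append_conv ncmonom.inject ncmonom.exhaust_sel plus_ncmonom_def)

lemma ncmonom_add_right_cancel: "v + u = w + u \<longleftrightarrow> v = w" for u v w :: ncmonom
  by (metis append_eq_append_conv ncmonom.inject ncmonom.exhaust_sel plus_ncmonom_def)

lemma lookup_single_times:
  "Poly_Mapping.lookup (Poly_Mapping.single u c * p) (u + w) = c * Poly_Mapping.lookup p w"
  for p :: "'f::field ncpoly"
  by (simp add: lookup_mult lookup_single when_mult mult_when ncmonom_add_left_cancel)

lemma lookup_times_single:
  "Poly_Mapping.lookup (p * Poly_Mapping.single u c) (w + u) = Poly_Mapping.lookup p w * c"
  for p :: "'f::field ncpoly"
proof -
  have "(\<Sum>q. (c when u = q) when w + u = l + q) = (c when w = l)" for l
  proof -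
    have "((c when u = q) when w + u = l + q) = ((c when w = l) when u = q)" for q
      by (auto simp: when_def ncmonom_add_right_cancel)
    then show ?thesis by simp
  qed
  then show ?thesis
    by (simp add: lookup_mult lookup_single when_mult mult_when ncmonom_add_right_cancel)
qed

lemma keys_single_times:
  fixes p :: "'f::field ncpoly"
  assumes "c \<noteq> 0"
  shows "Poly_Mapping.keys (Poly_Mapping.single u c * p) = (\<lambda>w. u + w) ` Poly_Mapping.keys p"
proof
  show "Poly_Mapping.keys (Poly_Mapping.single u c * p) \<subseteq> (\<lambda>w. u + w) ` Poly_Mapping.keys p"
    using keys_mult[of "Poly_Mapping.single u c" p] assms by auto
  show "(\<lambda>w. u + w) ` Poly_Mapping.keys p \<subseteq> Poly_Mapping.keys (Poly_Mapping.single u c * p)"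
    using assms by (auto simp: in_keys_iff lookup_single_times)
qed

lemma keys_times_single:
  fixes p :: "'f::field ncpoly"
  assumes "c \<noteq> 0"
  shows "Poly_Mapping.keys (p * Poly_Mapping.single u c) = (\<lambda>w. w + u) ` Poly_Mapping.keys p"
proof
  show "Poly_Mapping.keys (p * Poly_Mapping.single u c) \<subseteq> (\<lambda>w. w + u) ` Poly_Mapping.keys p"
    using keys_mult[of p "Poly_Mapping.single u c"] assms by auto
  show "(\<lambda>w. w + u) ` Poly_Mapping.keys p \<subseteq> Poly_Mapping.keys (p * Poly_Mapping.single u c)"
    using assms by (auto simp: in_keys_iff lookup_times_single)
qed

lemma lookup_homogeneous_component:
  "Poly_Mapping.lookup (homogeneous_component \<delta> n p) w =
     (if monom_degree \<delta> w = n then Poly_Mapping.lookup p w else 0)"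
  unfolding homogeneous_component_def lookup_sum
  by (auto simp: lookup_single when_def in_keys_iff sum.delta)

lemma homogeneous_component_diff:
  "homogeneous_component \<delta> n (p - q) = homogeneous_component \<delta> n p - homogeneous_component \<delta> n q"
  by (rule poly_mapping_eqI) (simp add: lookup_homogeneous_component lookup_minus)

text \<open>The zero polynomial is homogeneous of every degree.\<close>

definition homogeneous :: "(nat \<Rightarrow> nat) \<Rightarrow> nat \<Rightarrow> 'f::field ncpoly \<Rightarrow> bool" where
  "homogeneous \<delta> n p \<longleftrightarrow> (\<forall>w \<in> Poly_Mapping.keys p. monom_degree \<delta> w = n)"

lemma homogeneous_component_homogeneous:
  assumes "homogeneous \<delta> m p"
  shows "homogeneous_component \<delta> n p = (if n = m then p else 0)"
  using assms
  by (intro poly_mapping_eqI) (auto simp: lookup_homogeneous_component homogeneous_def in_keys_iff)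

lemma homogeneous_diff: "homogeneous \<delta> n p \<Longrightarrow> homogeneous \<delta> n q \<Longrightarrow> homogeneous \<delta> n (p - q)"
  using keys_diff[of p q] by (auto simp: homogeneous_def)

lemma homogeneous_mult:
  assumes "homogeneous \<delta> m p" "homogeneous \<delta> n q"
  shows "homogeneous \<delta> (m + n) (p * q)"
  using assms keys_mult[of p q]
  by (fastforce simp: homogeneous_def monom_degree_def plus_ncmonom_def)

lemma homogeneous_single: "monom_degree \<delta> w = n \<Longrightarrow> homogeneous \<delta> n (Poly_Mapping.single w c)"
  by (simp add: homogeneous_def)

lemma keys_empty_iff: "Poly_Mapping.keys p = {} \<longleftrightarrow> p = 0"
  for p :: "'f::field ncpoly"
  by (auto simp: poly_mapping_eq_iff fun_eq_iff in_keys_iff set_eq_iff)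

lemma scalar_commute: "Poly_Mapping.single 0 c * p = p * Poly_Mapping.single 0 c"
  for p :: "'f::field ncpoly"
  using lookup_single_times[of 0 c p] lookup_times_single[of p 0 c]
  by (intro poly_mapping_eqI) (simp add: mult.commute)

text \<open>The last case is restricted to the words of \<open>p\<close>, so that hypotheses on the support of \<open>p\<close>
  remain usable in the induction.\<close>

lemma ncpoly_induct [case_names zero add single]:
  fixes p :: "'f::field ncpoly"
  assumes "P 0" and "\<And>p q. P p \<Longrightarrow> P q \<Longrightarrow> P (p + q)"
    and "\<And>w c. w \<in> Poly_Mapping.keys p \<Longrightarrow> P (Poly_Mapping.single w c)"
  shows "P p"
proof -
  have "P (\<Sum>w\<in>S. Poly_Mapping.single w (Poly_Mapping.lookup p w))"
    if "finite S" "S \<subseteq> Poly_Mapping.keys p" for S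
    using that by (induction S rule: finite_induct) (simp_all add: assms)
  moreover have "(\<Sum>w\<in>Poly_Mapping.keys p. Poly_Mapping.single w (Poly_Mapping.lookup p w)) = p"
    by (rule poly_mapping_eqI) (simp add: lookup_sum lookup_single when_def in_keys_iff)
  ultimately show ?thesis
    by (metis finite_keys order_refl)
qed

section \<open>Ideals of the free algebra\<close>

lemma free_algebra_simps [simp]:
  "carrier (free_algebra d) = {p. Poly_Mapping.keys p \<subseteq> monoms d}"
  "mult (free_algebra d) = (*)" "one (free_algebra d) = 1"
  "zero (free_algebra d) = 0" "add (free_algebra d) = (+)"
  by (simp_all add: free_algebra_def)

lemma zero_in_monoms [simp]: "0 \<in> monoms d"
  by (simp add: monoms_def zero_ncmonom_def)

lemma add_in_monoms [simp]: "u + v \<in> monoms d \<longleftrightarrow> u \<in> monoms d \<and> v \<in> monoms d"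
  by (auto simp: monoms_def plus_ncmonom_def)

lemma keys_times_in_monoms:
  "Poly_Mapping.keys p \<subseteq> monoms d \<Longrightarrow> Poly_Mapping.keys q \<subseteq> monoms d \<Longrightarrow>
     Poly_Mapping.keys (p * q) \<subseteq> monoms d"
  using keys_mult[of p q] by fastforce

lemma
  assumes I: "ideal I (free_algebra d)"
  shows ideal_keys: "p \<in> I \<Longrightarrow> Poly_Mapping.keys p \<subseteq> monoms d"
    and ideal_zero: "0 \<in> I"
    and ideal_add: "p \<in> I \<Longrightarrow> q \<in> I \<Longrightarrow> p + q \<in> I"
    and ideal_left: "p \<in> I \<Longrightarrow> Poly_Mapping.keys q \<subseteq> monoms d \<Longrightarrow> q * p \<in> I"
    and ideal_right: "p \<in> I \<Longrightarrow> Poly_Mapping.keys q \<subseteq> monoms d \<Longrightarrow> p * q \<in> I"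
    and ideal_diff: "p \<in> I \<Longrightarrow> q \<in> I \<Longrightarrow> p - q \<in> I"
proof -
  interpret ideal I "free_algebra d" by (rule I)
  show "p \<in> I \<Longrightarrow> Poly_Mapping.keys p \<subseteq> monoms d" using Icarr by simp
  show "0 \<in> I" using additive_subgroup.zero_closed[OF is_additive_subgroup] by simp
  show add: "p \<in> I \<Longrightarrow> q \<in> I \<Longrightarrow> p + q \<in> I" for p q
    using additive_subgroup.a_closed[OF is_additive_subgroup, of p q] by simp
  show left: "p \<in> I \<Longrightarrow> Poly_Mapping.keys q \<subseteq> monoms d \<Longrightarrow> q * p \<in> I" for p q
    using I_l_closed by simp
  show "p \<in> I \<Longrightarrow> Poly_Mapping.keys q \<subseteq> monoms d \<Longrightarrow> p * q \<in> I" using I_r_closed by simp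
  show "p \<in> I \<Longrightarrow> q \<in> I \<Longrightarrow> p - q \<in> I"
    using add[of p "- 1 * q"] left[of q "- 1"] by simp
qed

lemma subgroup_free_algebraI:
  fixes N :: "'f::field ncpoly set"
  assumes "\<And>p. p \<in> N \<Longrightarrow> Poly_Mapping.keys p \<subseteq> monoms d"
    and "0 \<in> N" "\<And>p q. p \<in> N \<Longrightarrow> q \<in> N \<Longrightarrow> p - q \<in> N"
  shows "subgroup N (add_monoid (free_algebra d))"
proof -
  interpret ring "free_algebra d :: 'f ncpoly ring" by (rule ring_free_algebra)
  have minus: "- p \<in> N" if "p \<in> N" for p using assms(3)[OF assms(2) that] by simp
  have inv: "inv\<^bsub>add_monoid (free_algebra d)\<^esub> p = - p" if "p \<in> N" for p
    using assms(1)[OF that] minus_equality[of "- p" p] by (simp add: a_inv_def)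
  show ?thesis
  proof (rule subgroup.intro)
    show "p \<otimes>\<^bsub>add_monoid (free_algebra d)\<^esub> q \<in> N" if "p \<in> N" "q \<in> N" for p q
      using assms(3)[OF that(1) minus[OF that(2)]] by simp
  qed (use assms minus inv in auto)
qed

definition word_span :: "ncmonom set \<Rightarrow> 'f::field ncpoly set" where
  "word_span L = {p. Poly_Mapping.keys p \<subseteq> L}"

lemma word_span_ideal:
  assumes "L \<subseteq> monoms d"
    and "\<And>u w v. u \<in> monoms d \<Longrightarrow> w \<in> L \<Longrightarrow> v \<in> monoms d \<Longrightarrow> u + w + v \<in> L"
  shows "ideal (word_span L :: 'f::field ncpoly set) (free_algebra d)"
proof (rule idealI[OF ring_free_algebra])
  show "subgroup (word_span L :: 'f ncpoly set) (add_monoid (free_algebra d))"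
    using assms(1) keys_diff by (intro subgroup_free_algebraI) (fastforce simp: word_span_def)+
  show "q \<otimes>\<^bsub>free_algebra d\<^esub> p \<in> word_span L" "p \<otimes>\<^bsub>free_algebra d\<^esub> q \<in> word_span L"
    if "p \<in> word_span L" "q \<in> carrier (free_algebra d)" for p q :: "'f ncpoly"
  proof -
    have "u + w \<in> L" "w + u \<in> L" if "u \<in> monoms d" "w \<in> L" for u w
      using assms(2)[OF that zero_in_monoms] assms(2)[OF zero_in_monoms that(2,1)] by simp_all
    then show "q \<otimes>\<^bsub>free_algebra d\<^esub> p \<in> word_span L" "p \<otimes>\<^bsub>free_algebra d\<^esub> q \<in> word_span L"
      using that keys_mult[of p q] keys_mult[of q p] by (simp_all add: word_span_def) blast+
  qed
qed

lemma coset_eqD: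
  assumes I: "ideal I (free_algebra d)"
    and eq: "I +>\<^bsub>free_algebra d\<^esub> p = I +>\<^bsub>free_algebra d\<^esub> q"
  shows "p - q \<in> I"
proof -
  have "p \<in> I +>\<^bsub>free_algebra d\<^esub> p"
    using ideal_zero[OF I] by (force simp: a_r_coset_def')
  then show ?thesis
    unfolding eq by (auto simp: a_r_coset_def')
qed

text \<open>
  A subspace of finite dimension is represented by polynomials whose words all lie in one finite
  set, as adding a basis vector adds only the words of one representative.  The class of a word
  outside that set and outside \<open>L\<close> has no such representative.
\<close>

lemma infinite_dimensional_quotientI:
  fixes I :: "'f::field ncpoly set"
  assumes I: "ideal I (free_algebra d)"
    and sub: "I \<subseteq> word_span L" and inf: "infinite (monoms d - L)"
  shows "infinite_dimensional_quotient d I"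
proof -
  define R where "R = (free_algebra d :: 'f ncpoly ring)"
  interpret ideal I R unfolding R_def by (rule I)
  interpret Q: ring "R Quot I" by (rule quotient_is_ring)
  note hom = rcos_ring_hom
  have bounded: "\<exists>S. finite S \<and> S \<subseteq> monoms d \<and>
      (\<forall>C \<in> E. \<exists>p. Poly_Mapping.keys p \<subseteq> S \<and> C = I +>\<^bsub>R\<^esub> p)"
    if "Q.dimension n (quotient_scalars d I) E" for n E
    using that
  proof (induction "quotient_scalars d I" E rule: Q.dimension.induct)
    case zero_dim
    have "\<zero>\<^bsub>R Quot I\<^esub> = I +>\<^bsub>R\<^esub> 0"
      using ring_hom_zero[OF hom ring_axioms quotient_is_ring] by (simp add: R_def)
    then show ?case
      by (intro exI[of _ "{}"]) auto
  next
    case (Suc_dim v E n)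
    then obtain S where S: "finite S" "S \<subseteq> monoms d"
      "\<And>C. C \<in> E \<Longrightarrow> \<exists>p. Poly_Mapping.keys p \<subseteq> S \<and> C = I +>\<^bsub>R\<^esub> p"
      by auto
    obtain q where q: "q \<in> carrier R" "v = I +>\<^bsub>R\<^esub> q"
      using Suc_dim(1) by (auto simp: FactRing_def A_RCOSETS_def')
    have "\<exists>p. Poly_Mapping.keys p \<subseteq> Poly_Mapping.keys q \<union> S \<and> C = I +>\<^bsub>R\<^esub> p"
      if C: "C \<in> Q.line_extension (quotient_scalars d I) v E" for C
    proof -
      obtain c e where c: "C = ((I +>\<^bsub>R\<^esub> Poly_Mapping.single 0 c) \<otimes>\<^bsub>R Quot I\<^esub> v) \<oplus>\<^bsub>R Quot I\<^esub> e" and "e \<in> E"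
        using C unfolding Q.line_extension_def set_add_def set_mult_def r_coset_def quotient_scalars_def
        by (auto simp: R_def)
      then obtain p where p: "Poly_Mapping.keys p \<subseteq> S" "e = I +>\<^bsub>R\<^esub> p"
        using S(3) by blast
      have k: "Poly_Mapping.keys (Poly_Mapping.single 0 c * q) \<subseteq> Poly_Mapping.keys q"
        using keys_mult[of "Poly_Mapping.single 0 c" q] by (auto split: if_splits)
      have "C = I +>\<^bsub>R\<^esub> (Poly_Mapping.single 0 c * q + p)"
        using ring_hom_mult[OF hom, of "Poly_Mapping.single 0 c" q]
          ring_hom_add[OF hom, of "Poly_Mapping.single 0 c * q" p] q p c k S(2)
        by (auto simp: R_def)
      moreover have "Poly_Mapping.keys (Poly_Mapping.single 0 c * q + p) \<subseteq> Poly_Mapping.keys q \<union> S"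
        using keys_add[of "Poly_Mapping.single 0 c * q" p] k p(1) by blast
      ultimately show ?thesis by blast
    qed
    then show ?case
      using S(1,2) q(1) by (intro exI[of _ "Poly_Mapping.keys q \<union> S"]) (auto simp: R_def)
  qed
  have no_finite_set: False
    if S: "finite S" "\<forall>C \<in> carrier (R Quot I). \<exists>p. Poly_Mapping.keys p \<subseteq> S \<and> C = I +>\<^bsub>R\<^esub> p" for S
  proof -
    obtain w where w: "w \<in> monoms d" "w \<notin> L" "w \<notin> S"
      using inf S(1) by (metis Diff_iff finite_subset subsetI)
    have "I +>\<^bsub>R\<^esub> Poly_Mapping.single w 1 \<in> carrier (R Quot I)"
      using w(1) by (intro ring_hom_closed[OF hom]) (simp add: R_def)
    then obtain p where p: "Poly_Mapping.keys p \<subseteq> S"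
      "I +>\<^bsub>R\<^esub> Poly_Mapping.single w 1 = I +>\<^bsub>R\<^esub> p"
      using S(2) by blast
    then have "Poly_Mapping.single w 1 - p \<in> I"
      using coset_eqD[OF I] by (simp add: R_def)
    moreover have "w \<in> Poly_Mapping.keys (Poly_Mapping.single w 1 - p)"
    proof -
      have "Poly_Mapping.lookup p w = 0"
        using p(1) w(3) unfolding in_keys_iff[symmetric] not_in_keys_iff_lookup_eq_zero[symmetric]
        by blast
      then show ?thesis
        by (simp add: in_keys_iff lookup_minus)
    qed
    ultimately show False
      using sub w(2) by (auto simp: word_span_def)
  qed
  have "\<not> Q.finite_dimension (quotient_scalars d I) (carrier (R Quot I))"
  proof
    assume "Q.finite_dimension (quotient_scalars d I) (carrier (R Quot I))"
    then obtain n where "Q.dimension n (quotient_scalars d I) (carrier (R Quot I))"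
      unfolding Q.finite_dimension_def over_def by blast
    from bounded[OF this] no_finite_set show False
      by blast
  qed
  then show ?thesis
    unfolding infinite_dimensional_quotient_def R_def .
qed

section \<open>Leading words and normal forms\<close>

lemma leading_monom_exists:
  assumes r: "monomial_ordering d r" and p: "Poly_Mapping.keys p \<subseteq> monoms d" "p \<noteq> 0"
  shows "\<exists>w. leading_monom r p w"
proof -
  have lin: "refl_on (monoms d) r" "trans r" "total_on (monoms d) r"
    using r by (auto simp: monomial_ordering_def well_order_on_def linear_order_on_def
      partial_order_on_def preorder_on_def)
  have "\<exists>w \<in> S. \<forall>v \<in> S. (v, w) \<in> r" if "finite S" "S \<noteq> {}" "S \<subseteq> monoms d" for S
    using that
  proof (induction S rule: finite_ne_induct)
    case (singleton x)
    then show ?case using lin(1) by (auto simp: refl_on_def)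
  next
    case (insert x S)
    then obtain w where w: "w \<in> S" "\<forall>v \<in> S. (v, w) \<in> r" by auto
    have "(x, w) \<in> r \<or> (w, x) \<in> r"
      using lin(1,3) insert.prems w(1) unfolding refl_on_def total_on_def
      by (metis insert_subset subsetD)
    then show ?case
      using w insert.prems lin(1,2) by (auto simp: refl_on_def) (meson transD)+
  qed
  moreover have "Poly_Mapping.keys p \<noteq> {}"
    using p(2) by (simp add: keys_empty_iff)
  ultimately show ?thesis
    using p(1) finite_keys[of p] unfolding leading_monom_def by blast
qed

lemma leading_monom_translate:
  assumes r: "monomial_ordering d r" and w: "leading_monom r p w"
    and uv: "u \<in> monoms d" "v \<in> monoms d"
  shows "leading_monom r (Poly_Mapping.single u 1 * p * Poly_Mapping.single v 1) (u + w + v)"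
  using w uv r
  by (fastforce simp: leading_monom_def keys_single_times keys_times_single monomial_ordering_def)

text \<open>
  The set \<open>M\<close> consists of all words of a monomial ideal and not only of generators, whence the
  closure condition.
\<close>

locale deformation =
  fixes d :: nat and I :: "'f::field ncpoly set" and r :: "ncmonom rel" and M :: "ncmonom set"
  assumes ideal: "ideal I (free_algebra d)"
    and ordering: "monomial_ordering d r"
    and M_monoms: "M \<subseteq> monoms d"
    and M_closed: "u \<in> monoms d \<Longrightarrow> w \<in> M \<Longrightarrow> v \<in> monoms d \<Longrightarrow> u + w + v \<in> M"
    and leading: "leading_ideal d r I = Idl\<^bsub>free_algebra d\<^esub> ((\<lambda>w. Poly_Mapping.single w 1) ` M)"
begin

text \<open>
  The leading words of \<open>I\<close> are closed under multiplication by words, so their span is already the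
  leading ideal; the same holds for \<open>M\<close>, and a span of words determines the words.
\<close>

lemma leading_word_iff: "w \<in> M \<longleftrightarrow> (\<exists>p \<in> I. leading_monom r p w)"
proof -
  define L where "L = {w. \<exists>p \<in> I. leading_monom r p w}"
  interpret ring "free_algebra d :: 'f ncpoly ring" by (rule ring_free_algebra)
  have L_monoms: "L \<subseteq> monoms d"
    using ideal_keys[OF ideal] by (auto simp: L_def leading_monom_def)
  have L_closed: "u + w + v \<in> L" if uv: "u \<in> monoms d" "v \<in> monoms d" and "w \<in> L" for u w v
  proof -
    obtain p where p: "p \<in> I" "leading_monom r p w" using \<open>w \<in> L\<close> by (auto simp: L_def)
    have "Poly_Mapping.single u 1 * p * Poly_Mapping.single v 1 \<in> I"
      using p(1) uv by (intro ideal_right[OF ideal] ideal_left[OF ideal]) simp_all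
    then show ?thesis
      using leading_monom_translate[OF ordering p(2) uv] by (auto simp: L_def)
  qed
  have L_ideal: "ideal (word_span L :: 'f ncpoly set) (free_algebra d)"
    using L_monoms L_closed by (intro word_span_ideal) simp_all
  define G :: "'f ncpoly set" where "G = {Poly_Mapping.single w 1 |p w. p \<in> I \<and> leading_monom r p w}"
  define H :: "'f ncpoly set" where "H = (\<lambda>w. Poly_Mapping.single w 1) ` M"
  have GL: "G \<subseteq> word_span L" and HM: "H \<subseteq> word_span M"
    by (auto simp: G_def H_def L_def word_span_def)
  have carr: "G \<subseteq> carrier (free_algebra d)" "H \<subseteq> carrier (free_algebra d)"
    using GL HM L_monoms M_monoms by (fastforce simp: word_span_def)+
  have eq: "Idl\<^bsub>free_algebra d\<^esub> G = Idl\<^bsub>free_algebra d\<^esub> H"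
    using leading by (simp add: leading_ideal_def G_def H_def)
  have "G \<subseteq> word_span M"
    using genideal_self[OF carr(1)] genideal_minimal[OF word_span_ideal[OF M_monoms M_closed] HM] eq
    by simp
  moreover have "H \<subseteq> word_span L"
    using genideal_self[OF carr(2)] genideal_minimal[OF L_ideal GL] eq by simp
  moreover have "Poly_Mapping.single w (1 :: 'f) \<in> G" if "w \<in> L" for w
    using that by (auto simp: G_def L_def)
  ultimately have "Poly_Mapping.single w (1 :: 'f) \<in> word_span M" if "w \<in> L"
    using that by blast
  moreover have "Poly_Mapping.single w (1 :: 'f) \<in> word_span L" if "w \<in> M"
    using that \<open>H \<subseteq> word_span L\<close> by (auto simp: H_def)
  ultimately have "w \<in> L \<longleftrightarrow> w \<in> M"
    by (auto simp: word_span_def)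
  then show ?thesis by (simp add: L_def)
qed

lemma normal_form_unique:
  assumes "p \<in> I" "Poly_Mapping.keys p \<inter> M = {}"
  shows "p = 0"
proof (rule ccontr)
  assume "p \<noteq> 0"
  then obtain w where w: "leading_monom r p w"
    using leading_monom_exists[OF ordering ideal_keys[OF ideal assms(1)]] by blast
  then have "w \<in> M"
    using leading_word_iff assms(1) by blast
  then show False
    using assms(2) w by (auto simp: leading_monom_def)
qed

text \<open>
  Groebner reduction: by \<open>leading_word_iff\<close> a word of \<open>M\<close> is congruent to a combination of smaller
  words, and the ordering is well-founded.
\<close>

lemma normal_form_exists:
  assumes "Poly_Mapping.keys p \<subseteq> monoms d"
  shows "\<exists>q \<in> word_span (monoms d - M). p - q \<in> I"
proof -
  define R where "R = {p. \<exists>q \<in> word_span (monoms d - M). p - q \<in> I}"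
  have zero: "0 \<in> R"
    using ideal_zero[OF ideal] unfolding R_def word_span_def
    by (auto intro!: exI[of _ "0 :: 'f ncpoly"])
  have add: "p + q \<in> R" if pq: "p \<in> R" "q \<in> R" for p q
  proof -
    obtain p' q' where "p' \<in> word_span (monoms d - M)" "p - p' \<in> I"
      "q' \<in> word_span (monoms d - M)" "q - q' \<in> I"
      using pq by (auto simp: R_def)
    then have "p' + q' \<in> word_span (monoms d - M)" "(p + q) - (p' + q') \<in> I"
      using keys_add[of p' q'] ideal_add[OF ideal, of "p - p'" "q - q'"]
      by (auto simp: word_span_def algebra_simps)
    then show ?thesis by (auto simp: R_def)
  qed
  have scale: "Poly_Mapping.single 0 c * p \<in> R" if p: "p \<in> R" for p c
  proof -
    obtain p' where "p' \<in> word_span (monoms d - M)" "p - p' \<in> I"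
      using p by (auto simp: R_def)
    then have "Poly_Mapping.single 0 c * p' \<in> word_span (monoms d - M)"
      "Poly_Mapping.single 0 c * p - Poly_Mapping.single 0 c * p' \<in> I"
      using keys_mult[of "Poly_Mapping.single 0 c" p']
        ideal_left[OF ideal, of "p - p'" "Poly_Mapping.single 0 c"]
      by (auto simp: word_span_def right_diff_distrib split: if_splits)
    then show ?thesis by (auto simp: R_def)
  qed
  have linear: "p \<in> R" if words: "\<And>w. w \<in> Poly_Mapping.keys p \<Longrightarrow> Poly_Mapping.single w 1 \<in> R" for p
  proof (induction p rule: ncpoly_induct)
    case (single w c)
    then show ?case using scale[OF words, of w c] by (simp add: mult_single)
  qed (use zero add in auto)
  have cong: "p \<in> R" if pt: "p - t \<in> I" and t: "t \<in> R" for p t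
  proof -
    obtain t' where "t' \<in> word_span (monoms d - M)" "t - t' \<in> I"
      using t by (auto simp: R_def)
    then show ?thesis
      using ideal_add[OF ideal pt, of "t - t'"] by (auto simp: R_def)
  qed
  have "wf (r - Id)"
    using ordering by (auto simp: monomial_ordering_def well_order_on_def)
  then have word: "w \<in> monoms d \<longrightarrow> Poly_Mapping.single w 1 \<in> R" for w
  proof (induction w rule: wf_induct_rule)
    case (less w)
    show ?case
    proof (cases "w \<in> M")
      case False
      have "Poly_Mapping.single w (1 :: 'f) - Poly_Mapping.single w 1 \<in> I"
        using ideal_zero[OF ideal] by simp
      moreover have "Poly_Mapping.single w (1 :: 'f) \<in> word_span (monoms d - M)" if "w \<in> monoms d"
        using False that by (simp add: word_span_def)
      ultimately show ?thesis
        unfolding R_def by blast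
    next
      case True
      then obtain g where g: "g \<in> I" "leading_monom r g w"
        using leading_word_iff by blast
      define h where "h = Poly_Mapping.single 0 (inverse (Poly_Mapping.lookup g w)) * g"
      define t where "t = Poly_Mapping.single w 1 - h"
      have "h \<in> I"
        unfolding h_def using g(1) by (intro ideal_left[OF ideal]) simp_all
      have lh: "Poly_Mapping.lookup h v = inverse (Poly_Mapping.lookup g w) * Poly_Mapping.lookup g v" for v
        using lookup_single_times[of 0 _ g v] by (simp add: h_def)
      have "v \<in> Poly_Mapping.keys g \<and> v \<noteq> w" if "v \<in> Poly_Mapping.keys t" for v
      proof -
        have "v \<noteq> w"
          using that g(2) by (auto simp: t_def in_keys_iff lookup_minus lh leading_monom_def)
        then show ?thesis
          using that by (auto simp: t_def in_keys_iff lookup_minus lookup_single lh)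
      qed
      then have smaller: "(v, w) \<in> r - Id \<and> v \<in> monoms d" if "v \<in> Poly_Mapping.keys t" for v
        using that g(2) ideal_keys[OF ideal g(1)] unfolding leading_monom_def by blast
      have "t \<in> R"
      proof (rule linear)
        fix v
        assume "v \<in> Poly_Mapping.keys t"
        then show "Poly_Mapping.single v 1 \<in> R"
          using smaller[of v] less.IH[of v] by simp
      qed
      moreover have "Poly_Mapping.single w 1 - t \<in> I"
        using \<open>h \<in> I\<close> by (simp add: t_def)
      ultimately show ?thesis using cong by blast
    qed
  qed
  have "p \<in> R"
    by (rule linear) (use assms word in blast)
  then show ?thesis by (simp add: R_def)
qed

text \<open>Because \<open>I\<close> is homogeneous, the component of the right degree of any normal form is again a
  normal form.\<close>

lemma homogeneous_normal_form_exists: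
  assumes hom: "homogeneous_ideal d \<delta> I"
    and p: "Poly_Mapping.keys p \<subseteq> monoms d" "homogeneous \<delta> n p"
  shows "\<exists>q \<in> word_span (monoms d - M). homogeneous \<delta> n q \<and> p - q \<in> I"
proof -
  obtain q where q: "q \<in> word_span (monoms d - M)" "p - q \<in> I"
    using normal_form_exists[OF p(1)] by blast
  let ?q = "homogeneous_component \<delta> n q"
  have "homogeneous_component \<delta> n (p - q) \<in> I"
    using hom q(2) by (auto simp: homogeneous_ideal_def)
  then have "p - ?q \<in> I"
    by (simp add: homogeneous_component_diff homogeneous_component_homogeneous[OF p(2)])
  moreover have keys: "Poly_Mapping.keys ?q \<subseteq> {w \<in> Poly_Mapping.keys q. monom_degree \<delta> w = n}"
    by (auto simp: in_keys_iff lookup_homogeneous_component split: if_splits)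
  moreover have "?q \<in> word_span (monoms d - M)"
    using keys q(1) by (auto simp: word_span_def)
  ultimately show ?thesis
    by (auto simp: homogeneous_def intro!: bexI[of _ ?q])
qed

end

section \<open>The words of the example\<close>

definition power_word :: "nat \<Rightarrow> ncmonom" where
  "power_word n = NCMonom (replicate n 0)"

definition y_word :: ncmonom where
  "y_word = NCMonom [1]"

text \<open>
  With letter \<open>0\<close> for \<open>x\<close> and letter \<open>1\<close> for \<open>y\<close>, these are all words with a factor \<open>xy\<close>, \<open>yx\<close> or
  \<open>yy\<close>: a word of length at least two that contains \<open>y\<close> has a neighbour next to it.
\<close>

definition reducible_words :: "ncmonom set" where
  "reducible_words = {w \<in> monoms 2. 1 \<in> set (letters w) \<and> 2 \<le> length (letters w)}"

lemma normal_words: "monoms 2 - reducible_words = insert y_word (range power_word)"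
proof (intro subset_antisym subsetI)
  fix w
  assume w: "w \<in> monoms 2 - reducible_words"
  obtain ls where ls: "w = NCMonom ls" by (cases w)
  show "w \<in> insert y_word (range power_word)"
  proof (cases "1 \<in> set ls")
    case True
    then have "ls = [1]"
      using w ls by (cases ls rule: remdups_adj.cases) (auto simp: reducible_words_def)
    then show ?thesis using ls by (simp add: y_word_def)
  next
    case False
    have "i = 0" if "i \<in> set ls" for i
    proof -
      have "i < 2" "i \<noteq> 1"
        using w ls that False by (auto simp: monoms_def)
      then show ?thesis by linarith
    qed
    then have "ls = replicate (length ls) 0"
      by (intro replicate_eqI) simp_all
    then show ?thesis using ls by (auto simp: power_word_def)
  qed
next
  fix w
  assume "w \<in> insert y_word (range power_word)"
  then show "w \<in> monoms 2 - reducible_words"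
    by (auto simp: power_word_def y_word_def reducible_words_def monoms_def)
qed

lemma reducible_words_closed:
  "u \<in> monoms d \<Longrightarrow> w \<in> reducible_words \<Longrightarrow> v \<in> monoms d \<Longrightarrow> d \<le> 2 \<Longrightarrow> u + w + v \<in> reducible_words"
  by (fastforce simp: reducible_words_def monoms_def plus_ncmonom_def)

lemma power_word_add: "power_word m + power_word n = power_word (m + n)"
  by (simp add: power_word_def plus_ncmonom_def replicate_add)

lemma inj_power_word: "inj power_word"
  by (rule injI) (metis length_replicate ncmonom.inject power_word_def)

lemma monom_degree_power_word: "monom_degree \<delta> (power_word n) = n * \<delta> 0"
  by (simp add: monom_degree_def power_word_def sum_list_replicate)

text \<open>Distinct powers of \<open>x\<close> have distinct degrees since \<open>x\<close> has positive degree.\<close>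

lemma homogeneous_power_words:
  fixes q :: "'f::field ncpoly"
  assumes q: "q \<in> word_span (range power_word)" "homogeneous \<delta> n q" and "0 < \<delta> 0"
  shows "\<exists>m c. q = Poly_Mapping.single (power_word m) c"
proof (cases "Poly_Mapping.keys q = {}")
  case True
  then have "q = Poly_Mapping.single (power_word 0) 0"
    by (simp add: keys_empty_iff)
  then show ?thesis by blast
next
  case False
  then obtain m where m: "power_word m \<in> Poly_Mapping.keys q"
    using q(1) by (fastforce simp: word_span_def)
  have "w = power_word m" if w: "w \<in> Poly_Mapping.keys q" for w
  proof -
    obtain l where l: "w = power_word l"
      using w q(1) by (auto simp: word_span_def)
    have "monom_degree \<delta> (power_word l) = monom_degree \<delta> (power_word m)"
      using w l m q(2) by (simp add: homogeneous_def)
    then have "l * \<delta> 0 = m * \<delta> 0"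
      by (simp add: monom_degree_power_word)
    then show ?thesis using l assms(3) by simp
  qed
  then have "q = Poly_Mapping.single (power_word m) (Poly_Mapping.lookup q (power_word m))"
    by (intro poly_mapping_eqI) (auto simp: lookup_single when_def in_keys_iff)
  then show ?thesis by blast
qed

lemma monom_degree_y_word: "monom_degree \<delta> y_word = \<delta> 1"
  by (simp add: monom_degree_def y_word_def)

lemma y_word_ne_power_word [simp]: "y_word \<noteq> power_word n" "power_word n \<noteq> y_word"
  by (auto simp: power_word_def y_word_def Cons_replicate_eq dest: sym)

lemma words_in_monoms [simp]: "power_word n \<in> monoms 2" "y_word \<in> monoms 2"
  by (auto simp: power_word_def y_word_def monoms_def)

lemma power_words_commute:
  fixes f :: "'f::field ncpoly"
  assumes "f \<in> word_span (range power_word)"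
  shows "f * Poly_Mapping.single (power_word n) c = Poly_Mapping.single (power_word n) c * f"
proof (induction f rule: ncpoly_induct)
  case (single w b)
  then obtain m where "w = power_word m"
    using assms by (auto simp: word_span_def)
  then show ?case
    by (simp add: mult_single power_word_add add.commute mult.commute)
qed (simp_all add: algebra_simps)

section \<open>The left annihilator of x in a deformation\<close>

text \<open>The name refers to \<open>F\<langle>x, y\<rangle> / (xy, yx, y\<^sup>2)\<close> being commutative: it is the coordinate ring of
  a line with an embedded point.\<close>

locale line_point_deformation = deformation 2 I r reducible_words
  for I :: "'f::field ncpoly set" and r +
  fixes \<delta> :: "nat \<Rightarrow> nat"
  assumes degree_pos: "0 < \<delta> 0" "0 < \<delta> 1"
    and homogeneous: "homogeneous_ideal 2 \<delta> I"
begin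

abbreviation x :: "'f ncpoly" where
  "x \<equiv> Poly_Mapping.single (power_word 1) 1"

abbreviation y :: "'f ncpoly" where
  "y \<equiv> Poly_Mapping.single y_word 1"

lemma normal_form_zero:
  assumes "p \<in> I" "p \<in> word_span (monoms 2 - reducible_words)"
  shows "p = 0"
  using assms by (intro normal_form_unique) (auto simp: word_span_def)

text \<open>
  The normal form of \<open>yx\<close> has no term in \<open>y\<close> for degree reasons, so it is a multiple of one power
  of \<open>x\<close>.  Its exponent is of the form \<open>k + 1\<close> when the coefficient \<open>a\<close> is non-zero; then \<open>x\<^sup>k\<close> has the degree of
  \<open>y\<close>, which makes \<open>y - a x\<^sup>k\<close> homogeneous.
\<close>

lemma y_times_x:
  "\<exists>k a. (a = 0 \<or> k * \<delta> 0 = \<delta> 1) \<and> y * x - Poly_Mapping.single (power_word (Suc k)) a \<in> I"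
proof -
  have deg: "homogeneous \<delta> (\<delta> 1 + \<delta> 0) (y * x)"
    by (intro homogeneous_mult homogeneous_single) (simp_all add: monom_degree_y_word monom_degree_power_word)
  have "Poly_Mapping.keys (y * x) \<subseteq> monoms 2"
    by (intro keys_times_in_monoms) simp_all
  then obtain q where q: "q \<in> word_span (insert y_word (range power_word))"
      "homogeneous \<delta> (\<delta> 1 + \<delta> 0) q" "y * x - q \<in> I"
    using homogeneous_normal_form_exists[OF homogeneous _ deg] unfolding normal_words by blast
  have "y_word \<notin> Poly_Mapping.keys q"
    using q(2) degree_pos by (auto simp: homogeneous_def monom_degree_y_word)
  then have "q \<in> word_span (range power_word)"
    using q(1) by (auto simp: word_span_def)
  then obtain m c where m: "q = Poly_Mapping.single (power_word m) c"
    using homogeneous_power_words[OF _ q(2) degree_pos(1)] by blast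
  show ?thesis
  proof (cases "c = 0")
    case True
    then show ?thesis
      using q(3) m by (intro exI[of _ 0]) simp
  next
    case False
    then have eq: "m * \<delta> 0 = \<delta> 1 + \<delta> 0"
      using q(2) m by (simp add: homogeneous_def monom_degree_power_word)
    then obtain k where k: "m = Suc k"
      using degree_pos by (cases m) auto
    then have "k * \<delta> 0 = \<delta> 1"
      using eq by simp
    then show ?thesis
      using q(3) m k by blast
  qed
qed

text \<open>
  The witness is \<open>z = y - a x\<^sup>k\<close>.  In the basis of normal words \<open>y\<close> can be exchanged for \<open>z\<close>, so
  that \<open>z\<close> and the powers of \<open>x\<close> span the quotient; this is the last property.
\<close>

lemma annihilated_element:
  obtains z where "z \<in> word_span (monoms 2 - reducible_words)" "z \<noteq> 0" "homogeneous \<delta> (\<delta> 1) z"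
    "z * x \<in> I"
    "\<And>p. Poly_Mapping.keys p \<subseteq> monoms 2 \<Longrightarrow>
       \<exists>f \<in> word_span (range power_word). \<exists>s. p - (f + Poly_Mapping.single 0 s * z) \<in> I"
proof -
  obtain k a where k: "a = 0 \<or> k * \<delta> 0 = \<delta> 1"
      "y * x - Poly_Mapping.single (power_word (Suc k)) a \<in> I"
    using y_times_x by blast
  define z where "z = y - Poly_Mapping.single (power_word k) a"
  have keys: "Poly_Mapping.keys z \<subseteq> insert y_word (range power_word)"
    using keys_diff[of y "Poly_Mapping.single (power_word k) a"] by (auto simp: z_def split: if_splits)
  have zy: "Poly_Mapping.lookup z y_word = 1"
    by (simp add: z_def lookup_minus lookup_single)
  show thesis
  proof (rule that)
    show "z \<in> word_span (monoms 2 - reducible_words)"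
      using keys by (simp add: word_span_def normal_words)
    show "z \<noteq> 0"
      using zy by auto
    have "homogeneous \<delta> (\<delta> 1) (Poly_Mapping.single (power_word k) a)"
      using k(1) by (auto simp: homogeneous_def monom_degree_power_word)
    then show "homogeneous \<delta> (\<delta> 1) z"
      unfolding z_def
      by (intro homogeneous_diff[OF homogeneous_single[OF monom_degree_y_word]])
    show "z * x \<in> I"
      using k(2) by (simp add: z_def left_diff_distrib mult_single power_word_add)
    fix p :: "'f ncpoly"
    assume "Poly_Mapping.keys p \<subseteq> monoms 2"
    then obtain q where q: "q \<in> word_span (insert y_word (range power_word))" "p - q \<in> I"
      using normal_form_exists by (auto simp: normal_words)
    define s where "s = Poly_Mapping.lookup q y_word"
    define f where "f = q - Poly_Mapping.single 0 s * z"
    have lf: "Poly_Mapping.lookup f w = Poly_Mapping.lookup q w - s * Poly_Mapping.lookup z w" for w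
      using lookup_single_times[of 0 s z w] by (simp add: f_def lookup_minus)
    have "w \<in> range power_word" if "w \<in> Poly_Mapping.keys f" for w
    proof -
      have "w \<in> Poly_Mapping.keys q \<or> w \<in> Poly_Mapping.keys z"
        using that by (auto simp: in_keys_iff lf)
      moreover have "w \<noteq> y_word"
        using that zy by (auto simp: in_keys_iff lf s_def)
      ultimately show ?thesis
        using q(1) keys by (auto simp: word_span_def)
    qed
    then have "f \<in> word_span (range power_word)"
      by (auto simp: word_span_def)
    moreover have "p - (f + Poly_Mapping.single 0 s * z) \<in> I"
      using q(2) by (simp add: f_def)
    ultimately show "\<exists>f \<in> word_span (range power_word). \<exists>s. p - (f + Poly_Mapping.single 0 s * z) \<in> I"
      by blast
  qed
qed

definition annihilator :: "'f ncpoly set" where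
  "annihilator = {p. Poly_Mapping.keys p \<subseteq> monoms 2 \<and> p * x \<in> I}"

lemma ideal_cong:
  assumes "p - q \<in> I"
  shows "p \<in> I \<longleftrightarrow> q \<in> I"
  using ideal_diff[OF ideal _ assms, of p] ideal_add[OF ideal assms, of q] by auto

text \<open>
  For closure under multiplication by \<open>q\<close> from the right, \<open>q\<close> is replaced by a polynomial \<open>f\<close> in
  \<open>x\<close>, up to a multiple of \<open>z\<close>: then \<open>p q x \<equiv> p f x = p x f \<equiv> 0\<close> because \<open>z x \<equiv> 0\<close> and \<open>f\<close>
  commutes with \<open>x\<close>.
\<close>

lemma annihilator_ideal: "ideal annihilator (free_algebra 2)"
proof (rule idealI[OF ring_free_algebra])
  show "subgroup annihilator (add_monoid (free_algebra 2))"
  proof (rule subgroup_free_algebraI)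
    fix p q
    assume "p \<in> annihilator" "q \<in> annihilator"
    then show "p - q \<in> annihilator"
      using keys_diff[of p q] ideal_diff[OF ideal, of "p * x" "q * x"]
      by (auto simp: annihilator_def left_diff_distrib)
  qed (use ideal_zero[OF ideal] in \<open>auto simp: annihilator_def\<close>)
next
  fix p q :: "'f ncpoly"
  assume "p \<in> annihilator" "q \<in> carrier (free_algebra 2)"
  then have p: "Poly_Mapping.keys p \<subseteq> monoms 2" "p * x \<in> I"
    and q: "Poly_Mapping.keys q \<subseteq> monoms 2"
    by (simp_all add: annihilator_def)
  show "q \<otimes>\<^bsub>free_algebra 2\<^esub> p \<in> annihilator"
    using p q ideal_left[OF ideal p(2) q] keys_times_in_monoms[OF q p(1)]
    by (simp add: annihilator_def mult.assoc)
  obtain z where z: "z * x \<in> I"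
    "\<And>p. Poly_Mapping.keys p \<subseteq> monoms 2 \<Longrightarrow>
       \<exists>f \<in> word_span (range power_word). \<exists>s. p - (f + Poly_Mapping.single 0 s * z) \<in> I"
    using annihilated_element by metis
  obtain f s where f: "f \<in> word_span (range power_word)"
    "q - (f + Poly_Mapping.single 0 s * z) \<in> I"
    using z(2)[OF q] by blast
  have "(q - (f + Poly_Mapping.single 0 s * z)) * x + Poly_Mapping.single 0 s * (z * x) \<in> I"
    by (intro ideal_add[OF ideal] ideal_right[OF ideal f(2)] ideal_left[OF ideal z(1)]) simp_all
  then have "q * x - f * x \<in> I"
    by (simp add: algebra_simps)
  then have "p * (q * x - f * x) \<in> I"
    using p(1) by (rule ideal_left[OF ideal])
  moreover have "p * (f * x) \<in> I"
  proof -
    have "Poly_Mapping.keys f \<subseteq> monoms 2"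
      using f(1) by (auto simp: word_span_def)
    then have "p * x * f \<in> I"
      by (rule ideal_right[OF ideal p(2)])
    then show ?thesis
      by (simp add: power_words_commute[OF f(1)] mult.assoc)
  qed
  ultimately have "p * q * x \<in> I"
    using ideal_cong[of "p * (q * x)" "p * (f * x)"] by (simp add: right_diff_distrib mult.assoc)
  then show "p \<otimes>\<^bsub>free_algebra 2\<^esub> q \<in> annihilator"
    using keys_times_in_monoms[OF p(1) q] by (simp add: annihilator_def)
qed

text \<open>
  Modulo \<open>I\<close> the annihilator is the line spanned by \<open>z\<close>, as a polynomial in \<open>x\<close> annihilated by \<open>x\<close>
  vanishes.  So \<open>z\<^sup>2\<close> is a multiple of \<open>z\<close>, and it has twice the degree of \<open>z\<close>, which is positive.
\<close>

lemma annihilator_square_zero: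
  obtains z where "z \<in> annihilator" "z \<notin> I"
    "\<And>p q. p \<in> annihilator \<Longrightarrow> q \<in> annihilator \<Longrightarrow> p * q \<in> I"
proof -
  obtain z where z: "z \<in> word_span (monoms 2 - reducible_words)" "z \<noteq> 0" "homogeneous \<delta> (\<delta> 1) z"
    "z * x \<in> I"
    "\<And>p. Poly_Mapping.keys p \<subseteq> monoms 2 \<Longrightarrow>
       \<exists>f \<in> word_span (range power_word). \<exists>s. p - (f + Poly_Mapping.single 0 s * z) \<in> I"
    using annihilated_element by metis
  have keys_z: "Poly_Mapping.keys z \<subseteq> monoms 2"
    using z(1) by (auto simp: word_span_def)
  then have z_ann: "z \<in> annihilator"
    using z(4) by (simp add: annihilator_def)
  have multiple: "\<exists>s. p - Poly_Mapping.single 0 s * z \<in> I" if "p \<in> annihilator" for p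
  proof -
    have p: "Poly_Mapping.keys p \<subseteq> monoms 2" "p * x \<in> I"
      using that by (simp_all add: annihilator_def)
    obtain f s where f: "f \<in> word_span (range power_word)"
      "p - (f + Poly_Mapping.single 0 s * z) \<in> I"
      using z(5)[OF p(1)] by blast
    have "(p - (f + Poly_Mapping.single 0 s * z)) * x + Poly_Mapping.single 0 s * (z * x) \<in> I"
      by (intro ideal_add[OF ideal] ideal_right[OF ideal f(2)] ideal_left[OF ideal z(4)]) simp_all
    then have "f * x \<in> I"
      using ideal_cong[of "p * x" "f * x"] p(2) by (simp add: algebra_simps)
    moreover have keys: "Poly_Mapping.keys (f * x) = (\<lambda>w. w + power_word 1) ` Poly_Mapping.keys f"
      by (rule keys_times_single) simp
    moreover have "f * x \<in> word_span (monoms 2 - reducible_words)"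
      using f(1) unfolding word_span_def mem_Collect_eq keys normal_words
      by (auto simp: power_word_add)
    ultimately have "f * x = 0"
      by (intro normal_form_zero)
    then have "Poly_Mapping.keys f = {}"
      using keys unfolding \<open>f * x = 0\<close> by simp
    then have "f = 0"
      by (simp only: keys_empty_iff)
    then show ?thesis
      using f(2) by auto
  qed
  have zz: "z * z \<in> I"
  proof -
    have "z * z \<in> annihilator"
      using ideal_left[OF annihilator_ideal z_ann keys_z] .
    then obtain s where s: "z * z - Poly_Mapping.single 0 s * z \<in> I"
      using multiple by blast
    have "homogeneous \<delta> (0 + \<delta> 1) (Poly_Mapping.single 0 s * z)"
      using z(3) by (intro homogeneous_mult homogeneous_single)
        (simp_all add: monom_degree_def zero_ncmonom_def)
    moreover have "homogeneous_component \<delta> (\<delta> 1) (z * z - Poly_Mapping.single 0 s * z) \<in> I"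
      using homogeneous s by (auto simp: homogeneous_ideal_def)
    moreover have "\<delta> 1 \<noteq> \<delta> 1 + \<delta> 1"
      using degree_pos by simp
    ultimately have "0 - Poly_Mapping.single 0 s * z \<in> I"
      using homogeneous_component_homogeneous[OF homogeneous_mult[OF z(3) z(3)], of "\<delta> 1"]
      by (simp add: homogeneous_component_diff homogeneous_component_homogeneous[of _ "\<delta> 1"])
    then show ?thesis
      using ideal_diff[OF ideal s, of "0 - Poly_Mapping.single 0 s * z"] by simp
  qed
  show thesis
  proof (rule that[OF z_ann])
    show "z \<notin> I"
      using normal_form_zero z(1,2) by blast
    fix p q
    assume p: "p \<in> annihilator" and q: "q \<in> annihilator"
    obtain s t where st: "p - Poly_Mapping.single 0 s * z \<in> I" "q - Poly_Mapping.single 0 t * z \<in> I"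
      using multiple p q by blast
    have "(p - Poly_Mapping.single 0 s * z) * q \<in> I"
      using q by (intro ideal_right[OF ideal st(1)]) (simp add: annihilator_def)
    moreover have "Poly_Mapping.single 0 s * z * (q - Poly_Mapping.single 0 t * z) \<in> I"
      using keys_z by (intro ideal_left[OF ideal st(2)] keys_times_in_monoms) simp_all
    moreover have "Poly_Mapping.single 0 s * z * (Poly_Mapping.single 0 t * z) \<in> I"
    proof -
      have "Poly_Mapping.single 0 s * z * (Poly_Mapping.single 0 t * z) =
          Poly_Mapping.single 0 s * Poly_Mapping.single 0 t * (z * z)"
        by (metis mult.assoc scalar_commute)
      moreover have "\<dots> \<in> I"
        by (intro ideal_left[OF ideal zz] keys_times_in_monoms) simp_all
      ultimately show ?thesis by simp
    qed
    ultimately have "(p - Poly_Mapping.single 0 s * z) * q +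
        (Poly_Mapping.single 0 s * z * (q - Poly_Mapping.single 0 t * z) +
         Poly_Mapping.single 0 s * z * (Poly_Mapping.single 0 t * z)) \<in> I"
      by (intro ideal_add[OF ideal])
    then show "p * q \<in> I"
      by (simp add: algebra_simps)
  qed
qed

end

section \<open>Nilpotent ideals in quotients\<close>

lemma nilpotent_idealI:
  assumes R: "ring R" and N: "ideal N R"
    and square: "\<And>a b. a \<in> N \<Longrightarrow> b \<in> N \<Longrightarrow> a \<otimes>\<^bsub>R\<^esub> b = \<zero>\<^bsub>R\<^esub>"
  shows "nilpotent_ideal N R"
proof -
  interpret ring R by (rule R)
  (* The unit for the product of ideals is R, so the second power of N unfolds to (R N) N. *)
  let ?N1 = "carrier R \<cdot>\<^bsub>R\<^esub> N"
  have "?N1 \<subseteq> N"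
    using ideal_prod_inter[OF oneideal N] by blast
  have "s = \<zero>\<^bsub>R\<^esub>" if "s \<in> ?N1 \<cdot>\<^bsub>R\<^esub> N" for s
    using that
    by (induction s rule: ideal_prod.induct) (use \<open>?N1 \<subseteq> N\<close> square in auto)
  moreover have "\<zero>\<^bsub>R\<^esub> \<in> ?N1 \<cdot>\<^bsub>R\<^esub> N"
    using additive_subgroup.zero_closed[OF ideal.axioms(1)[OF ideal_prod_is_ideal[OF
      ideal_prod_is_ideal[OF oneideal N] N]]] .
  ultimately have "?N1 \<cdot>\<^bsub>R\<^esub> N = {\<zero>\<^bsub>R\<^esub>}"
    by blast
  moreover have "N [^]\<^bsub>ideals_set R\<^esub> (2 :: nat) = ?N1 \<cdot>\<^bsub>R\<^esub> N"
    by (simp add: nat_pow_def ideals_set_def numeral_2_eq_2)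
  ultimately show ?thesis
    using N unfolding nilpotent_ideal_def by metis
qed

lemma quotient_nilpotent_ideal:
  fixes I :: "'f::field ncpoly set"
  assumes I: "ideal I (free_algebra d)" and N: "ideal N (free_algebra d)"
    and square: "\<And>p q. p \<in> N \<Longrightarrow> q \<in> N \<Longrightarrow> p * q \<in> I"
    and z: "z \<in> N" "z \<notin> I"
  shows "\<exists>N. nilpotent_ideal N (free_algebra d Quot I) \<and> N \<noteq> {\<zero>\<^bsub>free_algebra d Quot I\<^esub>}"
proof -
  define R where "R = (free_algebra d :: 'f ncpoly ring)"
  interpret ideal I R unfolding R_def by (rule I)
  have zero: "\<zero>\<^bsub>R Quot I\<^esub> = I"
    by (simp add: FactRing_def)
  have coset: "I +>\<^bsub>R\<^esub> p = I \<longleftrightarrow> p \<in> I" if "Poly_Mapping.keys p \<subseteq> monoms d" for p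
    using that a_rcos_const[of p] a_rcos_self[of p] by (auto simp: R_def)
  have "nilpotent_ideal ((+>\<^bsub>R\<^esub>) I ` N) (R Quot I)"
  proof (rule nilpotent_idealI[OF quotient_is_ring])
    show "ideal ((+>\<^bsub>R\<^esub>) I ` N) (R Quot I)"
      using ring_ideal_imp_quot_ideal is_ideal N by (simp add: R_def)
    fix a b
    assume "a \<in> (+>\<^bsub>R\<^esub>) I ` N" "b \<in> (+>\<^bsub>R\<^esub>) I ` N"
    then obtain p q where pq: "p \<in> N" "a = I +>\<^bsub>R\<^esub> p" "q \<in> N" "b = I +>\<^bsub>R\<^esub> q"
      by blast
    then have "a \<otimes>\<^bsub>R Quot I\<^esub> b = I +>\<^bsub>R\<^esub> (p * q)"
      using ring_hom_mult[OF rcos_ring_hom, of p q] ideal_keys[OF N] by (simp add: R_def)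
    then show "a \<otimes>\<^bsub>R Quot I\<^esub> b = \<zero>\<^bsub>R Quot I\<^esub>"
      using coset[of "p * q"] square[OF pq(1,3)] ideal_keys[OF I] zero by simp
  qed
  moreover have "I +>\<^bsub>R\<^esub> z \<noteq> \<zero>\<^bsub>R Quot I\<^esub>"
    using coset[of z] z ideal_keys[OF N] zero by simp
  ultimately show ?thesis
    using z(1) unfolding R_def by blast
qed

section \<open>The existence theorem\<close>

theorem corollary5p6:
  shows "\<exists>(d::nat) (J :: 'f::field ncpoly set).
           monomial_ideal d J \<and>
           infinite_dimensional_quotient d J \<and>
           (\<forall>I. graded_deformation d J I \<longrightarrow>
              (\<exists>N. nilpotent_ideal N (free_algebra d Quot I) \<and>
                   N \<noteq> {\<zero>\<^bsub>free_algebra d Quot I\<^esub>}))"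
proof -
  interpret ring "free_algebra 2 :: 'f ncpoly ring" by (rule ring_free_algebra)
  define G :: "'f ncpoly set" where "G = (\<lambda>w. Poly_Mapping.single w 1) ` reducible_words"
  define J where "J = Idl\<^bsub>free_algebra 2\<^esub> G"
  have bad: "reducible_words \<subseteq> monoms 2"
    by (auto simp: reducible_words_def)
  have G: "G \<subseteq> word_span reducible_words"
    by (auto simp: G_def word_span_def)
  have "G \<subseteq> carrier (free_algebra 2)"
    using G bad by (fastforce simp: word_span_def)
  then have "ideal J (free_algebra 2)"
    unfolding J_def by (rule genideal_ideal)
  moreover have "J \<subseteq> word_span reducible_words"
    unfolding J_def
    by (rule genideal_minimal[OF word_span_ideal G]) (use bad reducible_words_closed in auto)
  moreover have "infinite (monoms 2 - reducible_words)"
    unfolding normal_words using range_inj_infinite[OF inj_power_word] by simp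
  ultimately have "infinite_dimensional_quotient 2 J"
    by (rule infinite_dimensional_quotientI)
  moreover have "monomial_ideal 2 J"
    using bad by (auto simp: monomial_ideal_def J_def G_def)
  moreover have "\<exists>N. nilpotent_ideal N (free_algebra 2 Quot I) \<and>
      N \<noteq> {\<zero>\<^bsub>free_algebra 2 Quot I\<^esub>}" if I: "graded_deformation 2 J I" for I
  proof -
    obtain \<delta> r where \<delta>: "\<forall>i<2. 0 < \<delta> i" "homogeneous_ideal 2 \<delta> I"
      and r: "monomial_ordering 2 r" "leading_ideal 2 r I = J"
      using I unfolding graded_deformation_def by blast
    interpret deformation 2 I r reducible_words
      using \<delta>(2) r bad reducible_words_closed[OF _ _ _ order_refl]
      by (intro deformation.intro) (simp_all add: homogeneous_ideal_def J_def G_def)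
    interpret line_point_deformation I r \<delta>
      using \<delta> by unfold_locales simp_all
    obtain z where "z \<in> annihilator" "z \<notin> I"
      "\<And>p q. p \<in> annihilator \<Longrightarrow> q \<in> annihilator \<Longrightarrow> p * q \<in> I"
      using annihilator_square_zero by blast
    then show ?thesis
      by (intro quotient_nilpotent_ideal[OF ideal annihilator_ideal])
  qed
  ultimately show ?thesis by blast
qed

end
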